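(* Let $A$ be a commutative Noetherian ring containing a field $K$ of characteristic zero, and let $M=\bigoplus_{n\in\mathbb{Z}}M_n$ be a generalized Eulerian $A_m(A)$-module. If $m\ge 2$, then the following assertions are equivalent: (i) $M_n\neq 0$ for all $n\in\mathbb{Z}$. (ii) There exists $r$ with $-m<r<0$ such that $M_r\neq 0$.
   Context: $A_m(A)=A\otimes_K A_m(K)=A\langle X_1,\ldots,X_m,\partial_1,\ldots,\partial_m\rangle$ is the $m$-th Weyl algebra over $A$: elements of $A$ are central, the $X_i$ commute with each other, the $\partial_i$ commute with each other, and $\partial_iX_j-X_j\partial_i=\delta_{ij}$. It is $\mathbb{Z}$-graded by $\deg z=0$ for $z\in A$, $\deg X_i=1$, $\deg\partial_i=-1$. Modules are left modules. The Euler operator is $\mathcal{E}_m=\sum_{i=1}^m X_i\partial_i$. A graded $A_m(A)$-module $M$ is generalized Eulerian if for each homogeneous $y\in M$ of degree $|y|$ there is a positive integer $a$ (depending on $y$) with $(\mathcal{E}_m-|y|)^a\cdot y=0$. *)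

theory Defs
  imports "HOL-Algebra.Subrings" "HOL-Algebra.Ring_Divisibility"
begin

section \<open>Free algebras over a commutative ring\<close>

text \<open>
  The elements of \<open>R\<langle>S\<rangle>\<close> are the finitely supported functions from words over \<open>S\<close> to
  coefficients in \<open>R\<close>, multiplied by convolution: the pairs of words with concatenation \<open>w\<close> are
  the pairs \<open>(take i w, drop i w)\<close> for \<open>i \<le> length w\<close>.
\<close>

hide_const (open) Multiset.mult

definition free_algebra :: "('a, 'r) ring_scheme \<Rightarrow> 'g set \<Rightarrow> ('g list \<Rightarrow> 'a) ring" where
  "free_algebra R S =
    \<lparr>carrier = {f. (\<forall>w. f w \<in> carrier R) \<and> finite {w. f w \<noteq> \<zero>\<^bsub>R\<^esub>} \<and> {w. f w \<noteq> \<zero>\<^bsub>R\<^esub>} \<subseteq> lists S},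
     mult = (\<lambda>f g w. \<Oplus>\<^bsub>R\<^esub>i\<in>{..length w}. f (take i w) \<otimes>\<^bsub>R\<^esub> g (drop i w)),
     one = (\<lambda>w. if w = [] then \<one>\<^bsub>R\<^esub> else \<zero>\<^bsub>R\<^esub>),
     zero = (\<lambda>w. \<zero>\<^bsub>R\<^esub>),
     add = (\<lambda>f g w. f w \<oplus>\<^bsub>R\<^esub> g w)\<rparr>"

definition free_gen :: "('a, 'r) ring_scheme \<Rightarrow> 'g \<Rightarrow> 'g list \<Rightarrow> 'a" where
  "free_gen R s = (\<lambda>w. if w = [s] then \<one>\<^bsub>R\<^esub> else \<zero>\<^bsub>R\<^esub>)"

lemma (in abelian_monoid) finsum_triangle:
  fixes n :: nat
  assumes "\<And>i j. F i j \<in> carrier G"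
  shows "(\<Oplus>i\<in>{..n}. \<Oplus>j\<in>{..i}. F j i) = (\<Oplus>j\<in>{..n}. \<Oplus>k\<in>{..n - j}. F j (j + k))"
proof (induction n)
  case 0
  show ?case using assms by simp
next
  case (Suc n)
  let ?I = "\<lambda>n j. \<Oplus>k\<in>{..n - j}. F j (j + k)"
  have cl: "?I n j \<in> carrier G" for n j using assms by simp
  have "(\<Oplus>j\<in>{..n}. ?I (Suc n) j) = (\<Oplus>j\<in>{..n}. F j (Suc n) \<oplus> ?I n j)"
    by (rule finsum_cong') (use assms cl in \<open>auto simp: Suc_diff_le\<close>)
  also have "\<dots> = (\<Oplus>j\<in>{..n}. F j (Suc n)) \<oplus> (\<Oplus>j\<in>{..n}. ?I n j)"
    using assms cl by (simp add: finsum_addf)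
  finally show ?case
    using Suc.IH assms cl by (simp add: a_ac)
qed

lemma (in ring) ring_free_algebra: "ring (free_algebra R S)"
proof -
  let ?F = "free_algebra R S"
  note defs = free_algebra_def
  have mult_closed: "f \<otimes>\<^bsub>?F\<^esub> g \<in> carrier ?F" if "f \<in> carrier ?F" "g \<in> carrier ?F" for f g
  proof -
    have cf: "f w \<in> carrier R" "g w \<in> carrier R" for w using that by (auto simp: defs)
    let ?U = "(\<lambda>(u, v). u @ v) ` ({w. f w \<noteq> \<zero>} \<times> {w. g w \<noteq> \<zero>})"
    let ?P = "{w. (\<Oplus>i\<in>{..length w}. f (take i w) \<otimes> g (drop i w)) \<noteq> \<zero>}"
    have sub: "?P \<subseteq> ?U"
    proof
      fix w assume "w \<in> ?P"
      then obtain i where "f (take i w) \<otimes> g (drop i w) \<noteq> \<zero>"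
        using add.finprod_one_eqI[of "{..length w}" "\<lambda>i. f (take i w) \<otimes> g (drop i w)"] by auto
      then have "f (take i w) \<noteq> \<zero>" "g (drop i w) \<noteq> \<zero>"
        using cf l_null r_null by metis+
      then show "w \<in> ?U" by (auto intro!: image_eqI[where x = "(take i w, drop i w)"])
    qed
    have "finite ?U" using that by (auto simp: defs)
    then have "finite ?P" by (rule finite_subset[OF sub])
    moreover have "?U \<subseteq> lists S" using that by (fastforce simp: defs)
    then have "?P \<subseteq> lists S" by (rule subset_trans[OF sub])
    ultimately show ?thesis using cf by (simp add: defs)
  qed
  show ?thesis
  proof (rule ringI)
    show "abelian_group ?F"
    proof (rule abelian_groupI)
      fix f g assume "f \<in> carrier ?F" "g \<in> carrier ?F"
      then have c: "\<forall>w. f w \<in> carrier R \<and> g w \<in> carrier R"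
        and U: "finite ({w. f w \<noteq> \<zero>} \<union> {w. g w \<noteq> \<zero>})"
          "{w. f w \<noteq> \<zero>} \<union> {w. g w \<noteq> \<zero>} \<subseteq> lists S" by (simp_all add: defs)
      have sub: "{w. f w \<oplus> g w \<noteq> \<zero>} \<subseteq> {w. f w \<noteq> \<zero>} \<union> {w. g w \<noteq> \<zero>}" by auto
      show "f \<oplus>\<^bsub>?F\<^esub> g \<in> carrier ?F"
        using c finite_subset[OF sub U(1)] subset_trans[OF sub U(2)] by (simp add: defs)
    next
      fix f assume f: "f \<in> carrier ?F"
      then have c: "f w \<in> carrier R" for w by (auto simp: defs)
      have "\<ominus> f w = \<zero> \<longleftrightarrow> f w = \<zero>" for w
        using c[of w] minus_minus[of "f w"] by auto
      then have "(\<lambda>w. \<ominus> f w) \<in> carrier ?F" using f by (auto simp: defs)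
      moreover have "(\<lambda>w. \<ominus> f w) \<oplus>\<^bsub>?F\<^esub> f = \<zero>\<^bsub>?F\<^esub>" using c by (auto simp: defs l_neg)
      ultimately show "\<exists>g\<in>carrier ?F. g \<oplus>\<^bsub>?F\<^esub> f = \<zero>\<^bsub>?F\<^esub>" by blast
    qed (auto simp: defs a_ac)
    show "Group.monoid ?F"
    proof (rule monoidI)
      fix f g h assume *: "f \<in> carrier ?F" "g \<in> carrier ?F" "h \<in> carrier ?F"
      then have c: "f w \<in> carrier R" "g w \<in> carrier R" "h w \<in> carrier R" for w
        by (auto simp: defs)
      have "(f \<otimes>\<^bsub>?F\<^esub> g \<otimes>\<^bsub>?F\<^esub> h) w = (f \<otimes>\<^bsub>?F\<^esub> (g \<otimes>\<^bsub>?F\<^esub> h)) w" for w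
      proof -
        let ?n = "length w"
        let ?T = "\<lambda>j i. f (take j w) \<otimes> g (drop j (take i w)) \<otimes> h (drop i w)"
        have "(f \<otimes>\<^bsub>?F\<^esub> g \<otimes>\<^bsub>?F\<^esub> h) w = (\<Oplus>i\<in>{..?n}. \<Oplus>j\<in>{..i}. ?T j i)"
          unfolding defs
          by (simp, rule finsum_cong') (use c in \<open>auto simp: finsum_ldistr min_def intro!: finsum_cong'\<close>)
        also have "\<dots> = (\<Oplus>j\<in>{..?n}. \<Oplus>k\<in>{..?n - j}. ?T j (j + k))"
          by (rule finsum_triangle) (use c in auto)
        also have "\<dots> = (f \<otimes>\<^bsub>?F\<^esub> (g \<otimes>\<^bsub>?F\<^esub> h)) w"
          unfolding defs
          by (simp, rule finsum_cong')
            (use c in \<open>auto simp: finsum_rdistr m_assoc drop_take add.commute intro!: finsum_cong'\<close>)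
        finally show ?thesis .
      qed
      then show "f \<otimes>\<^bsub>?F\<^esub> g \<otimes>\<^bsub>?F\<^esub> h = f \<otimes>\<^bsub>?F\<^esub> (g \<otimes>\<^bsub>?F\<^esub> h)" by (rule ext)
    next
      fix f assume f: "f \<in> carrier ?F"
      then have c: "f w \<in> carrier R" for w by (auto simp: defs)
      have "(\<one>\<^bsub>?F\<^esub> \<otimes>\<^bsub>?F\<^esub> f) w = f w" for w
      proof -
        have "(\<one>\<^bsub>?F\<^esub> \<otimes>\<^bsub>?F\<^esub> f) w = (\<Oplus>i\<in>{..length w}. if 0 = i then f (drop i w) else \<zero>)"
          unfolding defs by (simp, rule finsum_cong') (use c in auto)
        also have "\<dots> = f w"
          using add.finprod_singleton[of 0 "{..length w}" "\<lambda>i. f (drop i w)"] c by auto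
        finally show ?thesis .
      qed
      then show "\<one>\<^bsub>?F\<^esub> \<otimes>\<^bsub>?F\<^esub> f = f" by (rule ext)
      have "(f \<otimes>\<^bsub>?F\<^esub> \<one>\<^bsub>?F\<^esub>) w = f w" for w
      proof -
        have "(f \<otimes>\<^bsub>?F\<^esub> \<one>\<^bsub>?F\<^esub>) w = (\<Oplus>i\<in>{..length w}. if length w = i then f (take i w) else \<zero>)"
          unfolding defs by (simp, rule finsum_cong') (use c in auto)
        also have "\<dots> = f w"
          using add.finprod_singleton[of "length w" "{..length w}" "\<lambda>i. f (take i w)"] c by auto
        finally show ?thesis .
      qed
      then show "f \<otimes>\<^bsub>?F\<^esub> \<one>\<^bsub>?F\<^esub> = f" by (rule ext)
    next
      have "{w. w = [] \<and> \<one> \<noteq> \<zero>} \<subseteq> {[]}" by blast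
      then have "finite {w. w = [] \<and> \<one> \<noteq> \<zero>}" by (rule finite_subset) simp
      then show "\<one>\<^bsub>?F\<^esub> \<in> carrier ?F" by (auto simp: defs)
    qed (rule mult_closed)
  next
    fix f g h assume "f \<in> carrier ?F" "g \<in> carrier ?F" "h \<in> carrier ?F"
    then have c: "f w \<in> carrier R" "g w \<in> carrier R" "h w \<in> carrier R" for w
      by (auto simp: defs)
    show "(f \<oplus>\<^bsub>?F\<^esub> g) \<otimes>\<^bsub>?F\<^esub> h = f \<otimes>\<^bsub>?F\<^esub> h \<oplus>\<^bsub>?F\<^esub> g \<otimes>\<^bsub>?F\<^esub> h"
      using c by (auto simp: defs l_distr Pi_def finsum_addf)
    show "h \<otimes>\<^bsub>?F\<^esub> (f \<oplus>\<^bsub>?F\<^esub> g) = h \<otimes>\<^bsub>?F\<^esub> f \<oplus>\<^bsub>?F\<^esub> h \<otimes>\<^bsub>?F\<^esub> g"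
      using c by (auto simp: defs r_distr Pi_def finsum_addf)
  qed
qed


section \<open>The Weyl algebra\<close>

datatype weyl_gen = GX nat | GD nat

definition weyl_free :: "('a, 'r) ring_scheme \<Rightarrow> nat \<Rightarrow> (weyl_gen list \<Rightarrow> 'a) ring" where
  "weyl_free A m = free_algebra A (GX ` {1..m} \<union> GD ` {1..m})"

text \<open>
  Elements of \<open>A\<close> are already central in the free algebra, so only the relations between the
  generators are imposed.
\<close>

definition weyl_relators :: "('a, 'r) ring_scheme \<Rightarrow> nat \<Rightarrow> (weyl_gen list \<Rightarrow> 'a) set" where
  "weyl_relators A m =
    (let F = weyl_free A m; x = (\<lambda>i. free_gen A (GX i)); d = (\<lambda>i. free_gen A (GD i)) in
      {x i \<otimes>\<^bsub>F\<^esub> x j \<ominus>\<^bsub>F\<^esub> x j \<otimes>\<^bsub>F\<^esub> x i | i j. i \<in> {1..m} \<and> j \<in> {1..m}} \<union>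
      {d i \<otimes>\<^bsub>F\<^esub> d j \<ominus>\<^bsub>F\<^esub> d j \<otimes>\<^bsub>F\<^esub> d i | i j. i \<in> {1..m} \<and> j \<in> {1..m}} \<union>
      {(d i \<otimes>\<^bsub>F\<^esub> x j \<ominus>\<^bsub>F\<^esub> x j \<otimes>\<^bsub>F\<^esub> d i) \<ominus>\<^bsub>F\<^esub> (if i = j then \<one>\<^bsub>F\<^esub> else \<zero>\<^bsub>F\<^esub>) | i j.
        i \<in> {1..m} \<and> j \<in> {1..m}})"

definition weyl_ideal :: "('a, 'r) ring_scheme \<Rightarrow> nat \<Rightarrow> (weyl_gen list \<Rightarrow> 'a) set" where
  "weyl_ideal A m = Idl\<^bsub>weyl_free A m\<^esub> (weyl_relators A m)"

definition weyl_algebra :: "('a, 'r) ring_scheme \<Rightarrow> nat \<Rightarrow> (weyl_gen list \<Rightarrow> 'a) set ring" where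
  "weyl_algebra A m = weyl_free A m Quot weyl_ideal A m"

definition weyl_class ::
    "('a, 'r) ring_scheme \<Rightarrow> nat \<Rightarrow> (weyl_gen list \<Rightarrow> 'a) \<Rightarrow> (weyl_gen list \<Rightarrow> 'a) set" where
  "weyl_class A m f = weyl_ideal A m +>\<^bsub>weyl_free A m\<^esub> f"

definition weyl_X :: "('a, 'r) ring_scheme \<Rightarrow> nat \<Rightarrow> nat \<Rightarrow> (weyl_gen list \<Rightarrow> 'a) set" where
  "weyl_X A m i = weyl_class A m (free_gen A (GX i))"

definition weyl_D :: "('a, 'r) ring_scheme \<Rightarrow> nat \<Rightarrow> nat \<Rightarrow> (weyl_gen list \<Rightarrow> 'a) set" where
  "weyl_D A m i = weyl_class A m (free_gen A (GD i))"

definition euler_op :: "('a, 'r) ring_scheme \<Rightarrow> nat \<Rightarrow> (weyl_gen list \<Rightarrow> 'a) set" where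
  "euler_op A m =
    (\<Oplus>\<^bsub>weyl_algebra A m\<^esub>i\<in>{1..m}. weyl_X A m i \<otimes>\<^bsub>weyl_algebra A m\<^esub> weyl_D A m i)"

fun gen_deg :: "weyl_gen \<Rightarrow> int" where
  "gen_deg (GX i) = 1"
| "gen_deg (GD i) = - 1"

definition word_deg :: "weyl_gen list \<Rightarrow> int" where
  "word_deg w = (\<Sum>g\<leftarrow>w. gen_deg g)"

definition weyl_grading ::
    "('a, 'r) ring_scheme \<Rightarrow> nat \<Rightarrow> int \<Rightarrow> (weyl_gen list \<Rightarrow> 'a) set set" where
  "weyl_grading A m n =
    {weyl_class A m f | f. f \<in> carrier (weyl_free A m) \<and> (\<forall>w. f w \<noteq> \<zero>\<^bsub>A\<^esub> \<longrightarrow> word_deg w = n)}"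

lemma free_gen_closed:
  assumes "ring A" "s \<in> S"
  shows "free_gen A s \<in> carrier (free_algebra A S)"
proof -
  interpret A: ring A by fact
  have "{w. free_gen A s w \<noteq> \<zero>\<^bsub>A\<^esub>} \<subseteq> {[s]}" by (auto simp: free_gen_def)
  then show ?thesis
    using \<open>s \<in> S\<close> finite_subset by (fastforce simp: free_algebra_def free_gen_def)
qed

lemma ring_weyl_free: "ring A \<Longrightarrow> ring (weyl_free A m)"
  unfolding weyl_free_def by (rule ring.ring_free_algebra)

lemma weyl_relators_closed:
  assumes "ring A"
  shows "weyl_relators A m \<subseteq> carrier (weyl_free A m)"
proof -
  interpret F: ring "weyl_free A m" using assms by (rule ring_weyl_free)
  have "free_gen A (GX i) \<in> carrier (weyl_free A m)" "free_gen A (GD i) \<in> carrier (weyl_free A m)"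
    if "i \<in> {1..m}" for i
    unfolding weyl_free_def by (intro free_gen_closed[OF assms] UnI1 imageI that)
      (intro free_gen_closed[OF assms] UnI2 imageI that)
  then show ?thesis
    unfolding weyl_relators_def Let_def
    by (intro Un_least subsetI; clarify;
        intro F.minus_closed F.m_closed; simp del: One_nat_def split del: if_split; simp)
qed

lemma ideal_weyl_ideal: "ring A \<Longrightarrow> ideal (weyl_ideal A m) (weyl_free A m)"
  unfolding weyl_ideal_def
  by (intro ring.genideal_ideal ring_weyl_free weyl_relators_closed)

lemma ring_weyl_algebra: "ring A \<Longrightarrow> ring (weyl_algebra A m)"
  unfolding weyl_algebra_def by (intro ideal.quotient_is_ring ideal_weyl_ideal)


section \<open>Graded left modules and generalized Eulerian modules\<close>

text \<open>The locale \<open>module\<close> of HOL-Algebra requires a commutative ring of scalars.\<close>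

locale left_module = R?: ring R + M?: abelian_group M
  for R :: "('a, 'r) ring_scheme" (structure)
    and M :: "('a, 'b, 'c) module_scheme" (structure) +
  assumes smult_closed: "\<lbrakk>a \<in> carrier R; x \<in> carrier M\<rbrakk> \<Longrightarrow> a \<odot>\<^bsub>M\<^esub> x \<in> carrier M"
    and smult_l_distr: "\<lbrakk>a \<in> carrier R; b \<in> carrier R; x \<in> carrier M\<rbrakk> \<Longrightarrow>
      (a \<oplus>\<^bsub>R\<^esub> b) \<odot>\<^bsub>M\<^esub> x = a \<odot>\<^bsub>M\<^esub> x \<oplus>\<^bsub>M\<^esub> b \<odot>\<^bsub>M\<^esub> x"
    and smult_r_distr: "\<lbrakk>a \<in> carrier R; x \<in> carrier M; y \<in> carrier M\<rbrakk> \<Longrightarrow>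
      a \<odot>\<^bsub>M\<^esub> (x \<oplus>\<^bsub>M\<^esub> y) = a \<odot>\<^bsub>M\<^esub> x \<oplus>\<^bsub>M\<^esub> a \<odot>\<^bsub>M\<^esub> y"
    and smult_assoc: "\<lbrakk>a \<in> carrier R; b \<in> carrier R; x \<in> carrier M\<rbrakk> \<Longrightarrow>
      (a \<otimes>\<^bsub>R\<^esub> b) \<odot>\<^bsub>M\<^esub> x = a \<odot>\<^bsub>M\<^esub> (b \<odot>\<^bsub>M\<^esub> x)"
    and smult_one: "x \<in> carrier M \<Longrightarrow> \<one>\<^bsub>R\<^esub> \<odot>\<^bsub>M\<^esub> x = x"

text \<open>\<open>G\<close> is the grading of the ring, \<open>N n\<close> the homogeneous component of \<open>M\<close> of degree \<open>n\<close>.\<close>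

locale graded_left_module = left_module R M
  for R :: "('a, 'r) ring_scheme" (structure)
    and M :: "('a, 'b, 'c) module_scheme" (structure) +
  fixes G :: "int \<Rightarrow> 'a set" and N :: "int \<Rightarrow> 'b set"
  assumes component_subgroup: "additive_subgroup (N n) M"
    and direct_sum: "x \<in> carrier M \<Longrightarrow>
      \<exists>!f. (\<forall>n. f n \<in> N n) \<and> finite {n. f n \<noteq> \<zero>\<^bsub>M\<^esub>} \<and> x = (\<Oplus>\<^bsub>M\<^esub>n\<in>{n. f n \<noteq> \<zero>\<^bsub>M\<^esub>}. f n)"
    and smult_degree: "\<lbrakk>a \<in> G i; x \<in> N j\<rbrakk> \<Longrightarrow> a \<odot>\<^bsub>M\<^esub> x \<in> N (i + j)"

locale generalized_eulerian =
  graded_left_module "weyl_algebra A m" M "weyl_grading A m" N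
  for A :: "('a, 'r) ring_scheme" and m :: nat
    and M :: "((weyl_gen list \<Rightarrow> 'a) set, 'b, 'c) module_scheme" (structure)
    and N :: "int \<Rightarrow> 'b set" +
  assumes eulerian: "y \<in> N n \<Longrightarrow> \<exists>a::nat. a > 0 \<and>
    ((euler_op A m \<ominus>\<^bsub>weyl_algebra A m\<^esub> [n] \<cdot>\<^bsub>weyl_algebra A m\<^esub> \<one>\<^bsub>weyl_algebra A m\<^esub>)
      [^]\<^bsub>weyl_algebra A m\<^esub> a) \<odot>\<^bsub>M\<^esub> y = \<zero>\<^bsub>M\<^esub>"

end

theory Submission
  imports Defs
begin

text \<open>
  The proof rests on two observations about a nonzero homogeneous \<open>y\<close> of degree \<open>n\<close>.
  If every \<open>\<partial>\<^sub>i\<close> kills \<open>y\<close>, then \<open>\<E> y = 0\<close>.  If every \<open>X\<^sub>i\<close> kills \<open>y\<close>, then the relation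
  \<open>\<partial>\<^sub>i X\<^sub>i = X\<^sub>i \<partial>\<^sub>i + 1\<close> gives \<open>X\<^sub>i \<partial>\<^sub>i y = - y\<close> for each \<open>i\<close>, hence \<open>\<E> y = - m y\<close>.
  In either case \<open>y\<close> is an eigenvector of \<open>\<E>\<close> with an integer eigenvalue \<open>k\<close>, so
  \<open>(\<E> - n)\<^sup>a y = (k - n)\<^sup>a y\<close>, and since \<open>M\<close> is generalized Eulerian some such power vanishes.
  The ring \<open>A\<close> contains the inverses of all positive integers, which makes \<open>M\<close> torsion free;
  therefore \<open>k = n\<close> (lemma \<open>eulerian_eigenvalue\<close>).

  So multiplication by some \<open>\<partial>\<^sub>i\<close> carries \<open>N n \<noteq> 0\<close> to \<open>N (n - 1) \<noteq> 0\<close> unless \<open>n = 0\<close>, and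
  multiplication by some \<open>X\<^sub>i\<close> carries \<open>N n \<noteq> 0\<close> to \<open>N (n + 1) \<noteq> 0\<close> unless \<open>n = - m\<close>.  Starting
  strictly between \<open>- m\<close> and \<open>0\<close>, the descent never meets \<open>0\<close> and the ascent never meets \<open>- m\<close>,
  so every degree is reached.  Conversely, such a degree exists as soon as \<open>m \<ge> 2\<close>.
\<close>

section \<open>Integer multiples in left modules\<close>

context left_module
begin

lemma smult_hom_scalar:
  assumes "x \<in> carrier M"
  shows "group_hom (add_monoid R) (add_monoid M) (\<lambda>a. a \<odot>\<^bsub>M\<^esub> x)"
  using assms by (intro group_hom.intro group_hom_axioms.intro R.a_group M.a_group homI)
    (auto simp: smult_closed smult_l_distr)

lemma smult_hom_vector:
  assumes "a \<in> carrier R"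
  shows "group_hom (add_monoid M) (add_monoid M) (\<lambda>x. a \<odot>\<^bsub>M\<^esub> x)"
  using assms by (intro group_hom.intro group_hom_axioms.intro M.a_group homI)
    (auto simp: smult_closed smult_r_distr)

lemma smult_zero_vector: "a \<in> carrier R \<Longrightarrow> a \<odot>\<^bsub>M\<^esub> \<zero>\<^bsub>M\<^esub> = \<zero>\<^bsub>M\<^esub>"
  using group_hom.hom_one[OF smult_hom_vector] by simp

lemma smult_zero_scalar: "x \<in> carrier M \<Longrightarrow> \<zero>\<^bsub>R\<^esub> \<odot>\<^bsub>M\<^esub> x = \<zero>\<^bsub>M\<^esub>"
  using group_hom.hom_one[OF smult_hom_scalar] by simp

lemma smult_minus_scalar:
  "a \<in> carrier R \<Longrightarrow> x \<in> carrier M \<Longrightarrow> (\<ominus>\<^bsub>R\<^esub> a) \<odot>\<^bsub>M\<^esub> x = \<ominus>\<^bsub>M\<^esub> (a \<odot>\<^bsub>M\<^esub> x)"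
  using group_hom.hom_inv[OF smult_hom_scalar] by (simp add: a_inv_def)

lemma smult_int_multiple_scalar:
  fixes k :: int
  assumes "a \<in> carrier R" "x \<in> carrier M"
  shows "([k] \<cdot>\<^bsub>R\<^esub> a) \<odot>\<^bsub>M\<^esub> x = [k] \<cdot>\<^bsub>M\<^esub> (a \<odot>\<^bsub>M\<^esub> x)"
  using group_hom.hom_int_pow[OF smult_hom_scalar] assms by (simp add: add_pow_def)

lemma smult_int_multiple_vector:
  fixes k :: int
  assumes "a \<in> carrier R" "x \<in> carrier M"
  shows "a \<odot>\<^bsub>M\<^esub> ([k] \<cdot>\<^bsub>M\<^esub> x) = [k] \<cdot>\<^bsub>M\<^esub> (a \<odot>\<^bsub>M\<^esub> x)"
  using group_hom.hom_int_pow[OF smult_hom_vector] assms by (simp add: add_pow_def)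

lemma smult_finsum_scalar:
  assumes "finite I" "f \<in> I \<rightarrow> carrier R" "x \<in> carrier M"
  shows "(\<Oplus>\<^bsub>R\<^esub>i\<in>I. f i) \<odot>\<^bsub>M\<^esub> x = (\<Oplus>\<^bsub>M\<^esub>i\<in>I. f i \<odot>\<^bsub>M\<^esub> x)"
  using assms
proof (induction I rule: finite_induct)
  case empty
  then show ?case by (simp add: smult_zero_scalar)
next
  case (insert i I)
  then have "(\<lambda>i. f i \<odot>\<^bsub>M\<^esub> x) \<in> I \<rightarrow> carrier M" "f i \<odot>\<^bsub>M\<^esub> x \<in> carrier M"
    by (auto intro: smult_closed)
  with insert show ?case
    by (simp add: smult_l_distr Pi_def)
qed

text \<open>
  On \<open>x\<close> the operator \<open>a\<close> acts as the integer \<open>k\<close>, so \<open>a\<^sup>n x = k\<^sup>n x\<close>; cancelling one factor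
  \<open>k\<close> at a time lowers the exponent to \<open>0\<close>.
\<close>

lemma nilpotent_eigenvector_zero:
  fixes k :: int and n :: nat
  assumes a: "a \<in> carrier R" and x: "x \<in> carrier M"
    and eigen: "a \<odot>\<^bsub>M\<^esub> x = [k] \<cdot>\<^bsub>M\<^esub> x"
    and nil: "(a [^]\<^bsub>R\<^esub> n) \<odot>\<^bsub>M\<^esub> x = \<zero>\<^bsub>M\<^esub>"
    and cancel: "\<And>z. z \<in> carrier M \<Longrightarrow> [k] \<cdot>\<^bsub>M\<^esub> z = \<zero>\<^bsub>M\<^esub> \<Longrightarrow> z = \<zero>\<^bsub>M\<^esub>"
  shows "x = \<zero>\<^bsub>M\<^esub>"
  using nil
proof (induction n)
  case 0
  then show ?case using x by (simp add: smult_one)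
next
  case (Suc n)
  have p: "a [^]\<^bsub>R\<^esub> n \<in> carrier R" using a by simp
  have "(a [^]\<^bsub>R\<^esub> Suc n) \<odot>\<^bsub>M\<^esub> x = (a [^]\<^bsub>R\<^esub> n) \<odot>\<^bsub>M\<^esub> ([k] \<cdot>\<^bsub>M\<^esub> x)"
    using smult_assoc[OF p a x] by (simp add: eigen)
  also have "\<dots> = [k] \<cdot>\<^bsub>M\<^esub> ((a [^]\<^bsub>R\<^esub> n) \<odot>\<^bsub>M\<^esub> x)"
    using p x by (rule smult_int_multiple_vector)
  finally show ?case
    using Suc.prems cancel[OF smult_closed[OF p x]] Suc.IH by simp
qed

text \<open>
  A left inverse \<open>c\<close> of the scalar \<open>k\<close> recovers \<open>x\<close> as \<open>c (k x)\<close>.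
\<close>

lemma int_multiple_cancel:
  fixes k :: int
  assumes c: "c \<in> carrier R" "[k] \<cdot>\<^bsub>R\<^esub> c = \<one>\<^bsub>R\<^esub>"
    and x: "x \<in> carrier M" "[k] \<cdot>\<^bsub>M\<^esub> x = \<zero>\<^bsub>M\<^esub>"
  shows "x = \<zero>\<^bsub>M\<^esub>"
proof -
  have "x = ([k] \<cdot>\<^bsub>R\<^esub> c) \<odot>\<^bsub>M\<^esub> x" using c x by (simp add: smult_one)
  also have "\<dots> = c \<odot>\<^bsub>M\<^esub> ([k] \<cdot>\<^bsub>M\<^esub> x)"
    using c(1) x(1) by (simp only: smult_int_multiple_scalar smult_int_multiple_vector)
  finally show ?thesis using c x by (simp add: smult_zero_vector)
qed

end

lemma (in ring) int_multiple_invertible: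
  fixes k :: int
  assumes K: "subfield K R" and char0: "\<And>j::nat. j > 0 \<Longrightarrow> [j] \<cdot> \<one> \<noteq> \<zero>" and "k \<noteq> 0"
  shows "\<exists>u\<in>carrier R. [k] \<cdot> u = \<one>"
proof -
  have one: "\<one> \<in> K" using subringE(3)[OF subfieldE(1)[OF K]] .
  have nat_mem: "[j] \<cdot> \<one> \<in> K" for j :: nat
    by (induction j)
      (simp_all add: one subringE(2)[OF subfieldE(1)[OF K]] subringE(7)[OF subfieldE(1)[OF K]])
  have mem: "[k] \<cdot> \<one> \<in> K"
    using nat_mem[of "nat k"] subringE(5)[OF subfieldE(1)[OF K] nat_mem[of "nat (- k)"]]
    by (cases "k \<ge> 0") (simp_all add: add_pow_int_ge add_pow_int_lt)
  have "[k] \<cdot> \<one> \<noteq> \<zero>"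
  proof (cases "k > 0")
    case True
    then show ?thesis using char0[of "nat k"] by (simp add: add_pow_int_ge)
  next
    case False
    with \<open>k \<noteq> 0\<close> have "[nat (- k)] \<cdot> \<one> \<noteq> \<zero>" by (intro char0) simp
    then have "\<ominus> ([nat (- k)] \<cdot> \<one>) \<noteq> \<zero>"
      by (metis add.nat_pow_closed one_closed minus_minus minus_zero)
    with False \<open>k \<noteq> 0\<close> show ?thesis by (simp add: add_pow_int_lt)
  qed
  with mem have k: "[k] \<cdot> \<one> \<in> K - {\<zero>}" by simp
  have u: "inv ([k] \<cdot> \<one>) \<in> carrier R"
    using subfield_m_inv(1)[OF K k] subfieldE(3)[OF K] by blast
  have "[k] \<cdot> (inv ([k] \<cdot> \<one>)) = ([k] \<cdot> \<one>) \<otimes> inv ([k] \<cdot> \<one>)"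
    using u by (simp add: add_pow_ldistr_int)
  also have "\<dots> = \<one>" using subfield_m_inv(2)[OF K k] .
  finally show ?thesis using u by blast
qed


section \<open>Scalars and generators of the Weyl algebra\<close>

context
  fixes A :: "('a, 'r) ring_scheme" and m :: nat
  assumes A: "ring A"
begin

interpretation A: ring A by (rule A)
interpretation F: ring "weyl_free A m" by (rule ring_weyl_free[OF A])
interpretation I: ideal "weyl_ideal A m" "weyl_free A m" by (rule ideal_weyl_ideal[OF A])
interpretation W: ring "weyl_algebra A m" by (rule ring_weyl_algebra[OF A])

lemma weyl_class_hom: "ring_hom_ring (weyl_free A m) (weyl_algebra A m) (weyl_class A m)"
  using I.rcos_ring_hom_ring unfolding weyl_algebra_def weyl_class_def[abs_def] .

interpretation C: ring_hom_ring "weyl_free A m" "weyl_algebra A m" "weyl_class A m"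
  by (rule weyl_class_hom)

definition const_word :: "'a \<Rightarrow> weyl_gen list \<Rightarrow> 'a" where
  "const_word u = (\<lambda>w. if w = [] then u else \<zero>\<^bsub>A\<^esub>)"

lemma const_word_hom: "group_hom (add_monoid A) (add_monoid (weyl_free A m)) const_word"
proof (intro group_hom.intro group_hom_axioms.intro A.a_group F.a_group homI)
  fix u v
  assume uv: "u \<in> carrier (add_monoid A)" "v \<in> carrier (add_monoid A)"
  have "{w. const_word u w \<noteq> \<zero>\<^bsub>A\<^esub>} \<subseteq> {[]}" by (auto simp: const_word_def)
  then show "const_word u \<in> carrier (add_monoid (weyl_free A m))"
    using uv finite_subset by (fastforce simp: weyl_free_def free_algebra_def const_word_def)
  show "const_word (u \<otimes>\<^bsub>add_monoid A\<^esub> v) =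
      const_word u \<otimes>\<^bsub>add_monoid (weyl_free A m)\<^esub> const_word v"
    using uv by (auto simp: weyl_free_def free_algebra_def const_word_def)
qed

text \<open>
  The unit of the free algebra is the constant word \<open>1\<close>, so and the equation
  \<open>k u = 1\<close>, with \<open>k\<close> read as an iterated sum, is preserved by the additive map \<open>A \<rightarrow> A\<^sub>m(A)\<close>.
\<close>

lemma weyl_int_multiple_invertible:
  fixes k :: int
  assumes "u \<in> carrier A" "[k] \<cdot>\<^bsub>A\<^esub> u = \<one>\<^bsub>A\<^esub>"
  shows "\<exists>c\<in>carrier (weyl_algebra A m). [k] \<cdot>\<^bsub>weyl_algebra A m\<^esub> c = \<one>\<^bsub>weyl_algebra A m\<^esub>"
proof -
  interpret h: group_hom "add_monoid A" "add_monoid (weyl_free A m)" const_word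
    by (rule const_word_hom)
  have cu: "const_word u \<in> carrier (weyl_free A m)" using h.hom_closed assms by simp
  have "[k] \<cdot>\<^bsub>weyl_algebra A m\<^esub> weyl_class A m (const_word u)
      = weyl_class A m ([k] \<cdot>\<^bsub>weyl_free A m\<^esub> const_word u)"
    using group_hom.hom_int_pow[OF C.a_group_hom] cu by (simp add: add_pow_def)
  also have "[k] \<cdot>\<^bsub>weyl_free A m\<^esub> const_word u = const_word ([k] \<cdot>\<^bsub>A\<^esub> u)"
    using h.hom_int_pow[of u k] assms(1) by (simp add: add_pow_def)
  also have "\<dots> = \<one>\<^bsub>weyl_free A m\<^esub>"
    using assms(2) by (simp add: const_word_def weyl_free_def free_algebra_def)
  finally show ?thesis using cu C.hom_closed by (metis C.hom_one)
qed

lemma weyl_free_gen_closed: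
  assumes "i \<in> {1..m}"
  shows "free_gen A (GX i) \<in> carrier (weyl_free A m)" "free_gen A (GD i) \<in> carrier (weyl_free A m)"
  unfolding weyl_free_def using assms by (auto intro!: free_gen_closed[OF A])

lemma weyl_gen_closed:
  assumes "i \<in> {1..m}"
  shows "weyl_X A m i \<in> carrier (weyl_algebra A m)" "weyl_D A m i \<in> carrier (weyl_algebra A m)"
  unfolding weyl_X_def weyl_D_def using weyl_free_gen_closed[OF assms] by simp_all

lemma weyl_gen_degree:
  assumes "i \<in> {1..m}"
  shows "weyl_X A m i \<in> weyl_grading A m 1" "weyl_D A m i \<in> weyl_grading A m (- 1)"
  unfolding weyl_X_def weyl_D_def weyl_grading_def using weyl_free_gen_closed[OF assms]
  by (auto simp: free_gen_def word_deg_def split: if_splits intro!: exI)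

lemma weyl_D_X:
  assumes "i \<in> {1..m}"
  shows "weyl_D A m i \<otimes>\<^bsub>weyl_algebra A m\<^esub> weyl_X A m i =
    weyl_X A m i \<otimes>\<^bsub>weyl_algebra A m\<^esub> weyl_D A m i \<oplus>\<^bsub>weyl_algebra A m\<^esub> \<one>\<^bsub>weyl_algebra A m\<^esub>"
proof -
  let ?F = "weyl_free A m" and ?W = "weyl_algebra A m"
  let ?x = "free_gen A (GX i)" and ?d = "free_gen A (GD i)"
  let ?r = "(?d \<otimes>\<^bsub>?F\<^esub> ?x \<ominus>\<^bsub>?F\<^esub> ?x \<otimes>\<^bsub>?F\<^esub> ?d) \<ominus>\<^bsub>?F\<^esub> \<one>\<^bsub>?F\<^esub>"
  note gens = weyl_free_gen_closed[OF assms] and wgens = weyl_gen_closed[OF assms]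
  have "?r \<in> weyl_relators A m"
    unfolding weyl_relators_def Let_def using assms
    by (intro UnI2 CollectI exI[of _ i] conjI) (simp_all only: if_True refl)
  then have r: "?r \<in> weyl_ideal A m"
    unfolding weyl_ideal_def using F.genideal_self[OF weyl_relators_closed[OF A]] by blast
  then have "weyl_class A m ?r = \<zero>\<^bsub>?W\<^esub>"
    unfolding weyl_class_def weyl_algebra_def by (simp add: I.a_rcos_const FactRing_def)
  then have "(weyl_D A m i \<otimes>\<^bsub>?W\<^esub> weyl_X A m i \<ominus>\<^bsub>?W\<^esub> weyl_X A m i \<otimes>\<^bsub>?W\<^esub> weyl_D A m i)
      \<ominus>\<^bsub>?W\<^esub> \<one>\<^bsub>?W\<^esub> = \<zero>\<^bsub>?W\<^esub>"
    using gens by (simp add: a_minus_def weyl_X_def weyl_D_def)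
  moreover have "p = q \<oplus>\<^bsub>?W\<^esub> e"
    if "p \<in> carrier ?W" "q \<in> carrier ?W" "e \<in> carrier ?W" "(p \<ominus>\<^bsub>?W\<^esub> q) \<ominus>\<^bsub>?W\<^esub> e = \<zero>\<^bsub>?W\<^esub>" for p q e
  proof -
    have "p \<ominus>\<^bsub>?W\<^esub> q = e" using that W.r_right_minus_eq[of "p \<ominus>\<^bsub>?W\<^esub> q" e] by simp
    moreover have "q \<oplus>\<^bsub>?W\<^esub> (p \<ominus>\<^bsub>?W\<^esub> q) = p"
      using that W.r_neg1[of q p] W.a_comm[of p "\<ominus>\<^bsub>?W\<^esub> q"] W.r_neg2[of q p] by (simp add: a_minus_def)
    ultimately show ?thesis by simp
  qed
  ultimately show ?thesis using wgens by simp
qed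

end


section \<open>Eigenvectors of the Euler operator\<close>

context generalized_eulerian
begin

lemma component_closed: "y \<in> N n \<Longrightarrow> y \<in> carrier M"
  using additive_subgroup.a_subset[OF component_subgroup] by blast

lemma component_zero: "\<zero>\<^bsub>M\<^esub> \<in> N n"
  using additive_subgroup.zero_closed[OF component_subgroup] .

lemma euler_op_smult:
  assumes "ring A" "y \<in> carrier M"
  shows "euler_op A m \<in> carrier (weyl_algebra A m)"
    and "euler_op A m \<odot>\<^bsub>M\<^esub> y = (\<Oplus>\<^bsub>M\<^esub>i\<in>{1..m}. weyl_X A m i \<odot>\<^bsub>M\<^esub> (weyl_D A m i \<odot>\<^bsub>M\<^esub> y))"
proof -
  let ?W = "weyl_algebra A m"
  note gens = weyl_gen_closed[OF assms(1), of _ m]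
  show "euler_op A m \<in> carrier ?W"
    unfolding euler_op_def using gens by (intro R.finsum_closed) auto
  have "euler_op A m \<odot>\<^bsub>M\<^esub> y =
      (\<Oplus>\<^bsub>M\<^esub>i\<in>{1..m}. (weyl_X A m i \<otimes>\<^bsub>?W\<^esub> weyl_D A m i) \<odot>\<^bsub>M\<^esub> y)"
    unfolding euler_op_def using gens assms(2) by (intro smult_finsum_scalar) auto
  also have "\<dots> = (\<Oplus>\<^bsub>M\<^esub>i\<in>{1..m}. weyl_X A m i \<odot>\<^bsub>M\<^esub> (weyl_D A m i \<odot>\<^bsub>M\<^esub> y))"
    using gens assms(2) by (intro M.finsum_cong') (auto simp: smult_assoc intro!: smult_closed)
  finally show "euler_op A m \<odot>\<^bsub>M\<^esub> y = \<dots>" .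
qed

lemma euler_op_D_killed:
  assumes "ring A" "y \<in> carrier M"
    and "\<And>i. i \<in> {1..m} \<Longrightarrow> weyl_D A m i \<odot>\<^bsub>M\<^esub> y = \<zero>\<^bsub>M\<^esub>"
  shows "euler_op A m \<odot>\<^bsub>M\<^esub> y = [(0::int)] \<cdot>\<^bsub>M\<^esub> y"
proof -
  have "euler_op A m \<odot>\<^bsub>M\<^esub> y = (\<Oplus>\<^bsub>M\<^esub>i\<in>{1..m}. \<zero>\<^bsub>M\<^esub>)"
    unfolding euler_op_smult(2)[OF assms(1,2)] using weyl_gen_closed[OF assms(1), of _ m] assms(3)
    by (intro M.finsum_cong') (auto simp: smult_zero_vector)
  then show ?thesis by (simp add: add_pow_def)
qed

lemma euler_op_X_killed:
  assumes "ring A" and y: "y \<in> carrier M"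
    and kill: "\<And>i. i \<in> {1..m} \<Longrightarrow> weyl_X A m i \<odot>\<^bsub>M\<^esub> y = \<zero>\<^bsub>M\<^esub>"
  shows "euler_op A m \<odot>\<^bsub>M\<^esub> y = [(- int m)] \<cdot>\<^bsub>M\<^esub> y"
proof -
  let ?W = "weyl_algebra A m"
  note gens = weyl_gen_closed[OF assms(1), of _ m]
  have XD: "weyl_X A m i \<odot>\<^bsub>M\<^esub> (weyl_D A m i \<odot>\<^bsub>M\<^esub> y) = \<ominus>\<^bsub>M\<^esub> y" if i: "i \<in> {1..m}" for i
  proof -
    have cl: "weyl_X A m i \<odot>\<^bsub>M\<^esub> (weyl_D A m i \<odot>\<^bsub>M\<^esub> y) \<in> carrier M"
      using gens[OF i] y by (intro smult_closed)
    have "\<zero>\<^bsub>M\<^esub> = (weyl_D A m i \<otimes>\<^bsub>?W\<^esub> weyl_X A m i) \<odot>\<^bsub>M\<^esub> y"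
      using gens[OF i] y kill[OF i] by (simp add: smult_assoc smult_zero_vector)
    also have "\<dots> = weyl_X A m i \<odot>\<^bsub>M\<^esub> (weyl_D A m i \<odot>\<^bsub>M\<^esub> y) \<oplus>\<^bsub>M\<^esub> y"
      using gens[OF i] y
      by (simp add: weyl_D_X[OF assms(1) i] smult_l_distr smult_assoc smult_one)
    finally show ?thesis using M.minus_equality[OF _ y cl] by simp
  qed
  have "euler_op A m \<odot>\<^bsub>M\<^esub> y = (\<Oplus>\<^bsub>M\<^esub>i\<in>{1..m}. \<ominus>\<^bsub>M\<^esub> y)"
    unfolding euler_op_smult(2)[OF assms(1) y] using y XD by (intro M.finsum_cong') auto
  also have "\<dots> = [m] \<cdot>\<^bsub>M\<^esub> (\<ominus>\<^bsub>M\<^esub> y)"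
    using M.add.finprod_const[of "\<ominus>\<^bsub>M\<^esub> y" "{1..m}"] y by simp
  also have "\<dots> = [(- int m)] \<cdot>\<^bsub>M\<^esub> y"
    using y M.add.int_pow_neg_int[OF y, of m] M.add.nat_pow_inv[OF y, of m] by simp
  finally show ?thesis .
qed

text \<open>
  On \<open>N n\<close> the operator \<open>\<E> - n\<close> is locally nilpotent, so there \<open>\<E>\<close> has no integer eigenvalue
  other than \<open>n\<close>.
\<close>

lemma eulerian_eigenvalue:
  fixes k :: int
  assumes A: "ring A" and y: "y \<in> N n" "y \<noteq> \<zero>\<^bsub>M\<^esub>"
    and eigen: "euler_op A m \<odot>\<^bsub>M\<^esub> y = [k] \<cdot>\<^bsub>M\<^esub> y"
    and inv: "\<And>j::int. j \<noteq> 0 \<Longrightarrow> \<exists>u\<in>carrier A. [j] \<cdot>\<^bsub>A\<^esub> u = \<one>\<^bsub>A\<^esub>"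
  shows "k = n"
proof (rule ccontr)
  assume "k \<noteq> n"
  let ?W = "weyl_algebra A m"
  let ?e = "euler_op A m \<ominus>\<^bsub>?W\<^esub> [n] \<cdot>\<^bsub>?W\<^esub> \<one>\<^bsub>?W\<^esub>"
  have yM: "y \<in> carrier M" using y(1) by (rule component_closed)
  note E = euler_op_smult(1)[OF A yM]
  have n1: "[n] \<cdot>\<^bsub>?W\<^esub> \<one>\<^bsub>?W\<^esub> \<in> carrier ?W" by simp
  obtain a :: nat where nil: "(?e [^]\<^bsub>?W\<^esub> a) \<odot>\<^bsub>M\<^esub> y = \<zero>\<^bsub>M\<^esub>"
    using eulerian[OF y(1)] by blast
  have "?e \<odot>\<^bsub>M\<^esub> y = [k] \<cdot>\<^bsub>M\<^esub> y \<oplus>\<^bsub>M\<^esub> \<ominus>\<^bsub>M\<^esub> ([n] \<cdot>\<^bsub>M\<^esub> y)"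
    using E n1 yM
    by (simp add: a_minus_def smult_l_distr smult_minus_scalar smult_int_multiple_scalar
        smult_one eigen)
  also have "\<dots> = [(k - n)] \<cdot>\<^bsub>M\<^esub> y"
    using yM by (simp add: M.add.int_pow_diff)
  finally have eig: "?e \<odot>\<^bsub>M\<^esub> y = [(k - n)] \<cdot>\<^bsub>M\<^esub> y" .
  have e: "?e \<in> carrier ?W" using E n1 by (rule R.minus_closed)
  obtain u where "u \<in> carrier A" "[(k - n)] \<cdot>\<^bsub>A\<^esub> u = \<one>\<^bsub>A\<^esub>"
    using inv[of "k - n"] \<open>k \<noteq> n\<close> by auto
  then obtain c where "c \<in> carrier ?W" "[(k - n)] \<cdot>\<^bsub>?W\<^esub> c = \<one>\<^bsub>?W\<^esub>"
    using weyl_int_multiple_invertible[OF A] by blast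
  then have "y = \<zero>\<^bsub>M\<^esub>"
    using nilpotent_eigenvector_zero[OF e yM eig nil] int_multiple_cancel by blast
  with y(2) show False by contradiction
qed

lemma component_nonzero_up:
  assumes A: "ring A" and inv: "\<And>j::int. j \<noteq> 0 \<Longrightarrow> \<exists>u\<in>carrier A. [j] \<cdot>\<^bsub>A\<^esub> u = \<one>\<^bsub>A\<^esub>"
    and "N n \<noteq> {\<zero>\<^bsub>M\<^esub>}" "n \<noteq> - int m"
  shows "N (n + 1) \<noteq> {\<zero>\<^bsub>M\<^esub>}"
proof
  assume z: "N (n + 1) = {\<zero>\<^bsub>M\<^esub>}"
  obtain y where y: "y \<in> N n" "y \<noteq> \<zero>\<^bsub>M\<^esub>" using assms(3) component_zero by blast
  have "weyl_X A m i \<odot>\<^bsub>M\<^esub> y = \<zero>\<^bsub>M\<^esub>" if "i \<in> {1..m}" for i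
    using smult_degree[OF weyl_gen_degree(1)[OF A that] y(1)] z by (simp add: add.commute)
  then have "- int m = n"
    by (intro eulerian_eigenvalue[OF A y _ inv] euler_op_X_killed A component_closed[OF y(1)])
  with assms(4) show False by simp
qed

lemma component_nonzero_down:
  assumes A: "ring A" and inv: "\<And>j::int. j \<noteq> 0 \<Longrightarrow> \<exists>u\<in>carrier A. [j] \<cdot>\<^bsub>A\<^esub> u = \<one>\<^bsub>A\<^esub>"
    and "N n \<noteq> {\<zero>\<^bsub>M\<^esub>}" "n \<noteq> 0"
  shows "N (n - 1) \<noteq> {\<zero>\<^bsub>M\<^esub>}"
proof
  assume z: "N (n - 1) = {\<zero>\<^bsub>M\<^esub>}"
  obtain y where y: "y \<in> N n" "y \<noteq> \<zero>\<^bsub>M\<^esub>" using assms(3) component_zero by blast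
  have "weyl_D A m i \<odot>\<^bsub>M\<^esub> y = \<zero>\<^bsub>M\<^esub>" if "i \<in> {1..m}" for i
    using smult_degree[OF weyl_gen_degree(2)[OF A that] y(1)] z by simp
  then have "0 = n"
    by (intro eulerian_eigenvalue[OF A y _ inv] euler_op_D_killed A component_closed[OF y(1)])
  with assms(4) show False by simp
qed

end


section \<open>Rigidity of generalized Eulerian modules\<close>

theorem theorem7p2:
  fixes A :: "('a, 'r) ring_scheme"
    and K :: "'a set"
    and m :: nat
    and M :: "((weyl_gen list \<Rightarrow> 'a) set, 'b, 'c) module_scheme"
    and N :: "int \<Rightarrow> 'b set"
  assumes "cring A" and "noetherian_ring A"
    and "subfield K A" and "\<And>k::nat. k > 0 \<Longrightarrow> [k] \<cdot>\<^bsub>A\<^esub> \<one>\<^bsub>A\<^esub> \<noteq> \<zero>\<^bsub>A\<^esub>"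
    and "generalized_eulerian A m M N"
    and "m \<ge> 2"
  shows "(\<forall>n. N n \<noteq> {\<zero>\<^bsub>M\<^esub>}) \<longleftrightarrow> (\<exists>r. - int m < r \<and> r < 0 \<and> N r \<noteq> {\<zero>\<^bsub>M\<^esub>})"
proof
  assume "\<forall>n. N n \<noteq> {\<zero>\<^bsub>M\<^esub>}"
  with \<open>m \<ge> 2\<close> show "\<exists>r. - int m < r \<and> r < 0 \<and> N r \<noteq> {\<zero>\<^bsub>M\<^esub>}"
    by (intro exI[of _ "- 1"]) simp
next
  assume "\<exists>r. - int m < r \<and> r < 0 \<and> N r \<noteq> {\<zero>\<^bsub>M\<^esub>}"
  then obtain r where r: "- int m < r" "r < 0" "N r \<noteq> {\<zero>\<^bsub>M\<^esub>}" by blast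
  interpret generalized_eulerian A m M N by fact
  have A: "ring A" using \<open>cring A\<close> by (rule cring.axioms(1))
  note inv = ring.int_multiple_invertible[OF A assms(3,4)]
  show "\<forall>n. N n \<noteq> {\<zero>\<^bsub>M\<^esub>}"
  proof
    fix n
    show "N n \<noteq> {\<zero>\<^bsub>M\<^esub>}"
    proof (induction n rule: int_induct[where k = r])
      case base
      show ?case by (fact r(3))
    next
      case (step1 n)
      then show ?case using r(1) by (intro component_nonzero_up[OF A inv]) auto
    next
      case (step2 n)
      then show ?case using r(2) by (intro component_nonzero_down[OF A inv]) auto
    qed
  qed
qed

end
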